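(* Let $F=(f_1,\dots,f_m):\mathbb{R}^n\to\mathbb{R}^m$ be continuously differentiable, let $\sigma\in[0,1)$, $\beta\in(0,1)$ and $x^0\in\mathbb{R}^n$, and let $\{x^k\},\{v^k\},\{t_k\}$ be infinite sequences generated from $x^0$ by the inexact steepest descent method with Armijo rule. Assume that each $v^k$ is scalarization compatible, i.e. there is a sequence $\{w^k\}\subset\operatorname{conv} S$ with $v^k=-JF(x^k)^t w^k$ for all $k=0,1,\dots$. If $F$ is pseudo-convex and the set $$U:=\{x\in\mathbb{R}^n:\ F(x)\preceq F(x^k),\ k=0,1,\dots\}$$ is nonempty, then the sequence $\{x^k\}$ converges to a weak optimal Pareto point of $F$.
   Context: Order: for $x,y\in\mathbb{R}^m$, $x\preceq y$ means $y_i-x_i\ge 0$ for all $i$, and $x\prec y$ means $y_i-x_i>0$ for all $i$. Let $I=\{1,\dots,m\}$; norms and inner products are Euclidean. $JF(x)$ is the Jacobian, acting by $JF(x)v=(\langle\nabla f_1(x),v\rangle,\dots,\langle\nabla f_m(x),v\rangle)$, and $JF(x)^t$ is its transpose. $S=\{e_1,\dots,e_m\}$ is the canonical basis of $\mathbb{R}^m$ and $\operatorname{conv}S$ its convex hull. Critical Pareto point: $x\in\mathbb{R}^n$ such that there is no $v\in\mathbb{R}^n$ with $JF(x)v\prec 0$. Weak optimal Pareto point: $x^*\in\mathbb{R}^n$ such that there is no $x\in\mathbb{R}^n$ with $F(x)\prec F(x^* )$. Set $\alpha(x):=\min_{v\in\mathbb{R}^n}\{\max_{i\in I}\langle\nabla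 f_i(x),v\rangle+\tfrac12\|v\|^2\}$. For $\sigma\in[0,1)$, a vector $v\in\mathbb{R}^n$ is a $\sigma$-approximate steepest descent direction at $x$ for $F$ if $\max_{i\in I}\langle\nabla f_i(x),v\rangle+\tfrac12\|v\|^2\le(1-\sigma)\alpha(x)$. Inexact steepest descent method with Armijo rule: given $\beta\in(0,1)$, $x^0\in\mathbb{R}^n$, for $k=0,1,\dots$: if $x^k$ is a critical Pareto point, stop. Otherwise choose a $\sigma$-approximate steepest descent direction $v^k$ for $F$ at $x^k$, put $$t_k:=\max\{2^{-j}: j\in\{0,1,2,\dots\},\ F(x^k+2^{-j}v^k)\preceq F(x^k)+\beta 2^{-j}JF(x^k)v^k\}$$ and $x^{k+1}:=x^k+t_kv^k$. That the sequences are infinite means the method never stops. $F$ is pseudo-convex if it is differentiable and for all $x,y\in\mathbb{R}^n$: $JF(x)(y-x)\not\prec 0$ implies $F(y)\not\prec F(x)$. *)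

theory Defs
  imports "HOL-Analysis.Analysis"
begin

text \<open>The order \<open>\<preceq>\<close> on \<open>\<real>\<^sup>m\<close> is the library's componentwise \<open>(\<le>)\<close> on vectors.  The library's
  \<open>(<)\<close> on vectors is only \<open>x \<le> y \<and> \<not> y \<le> x\<close>, so \<open>\<prec>\<close> needs a relation of its own.\<close>

definition strictly_below :: "real ^ 'm \<Rightarrow> real ^ 'm \<Rightarrow> bool" (infix "\<prec>" 50)
  where "x \<prec> y \<longleftrightarrow> (\<forall>i. x $ i < y $ i)"

text \<open>\<open>JF x\<close> is the library's \<^const>\<open>jacobian\<close>, whose \<open>i\<close>-th row is the gradient of the \<open>i\<close>-th
  component function.\<close>

abbreviation Jac :: "(real ^ 'n \<Rightarrow> real ^ 'm) \<Rightarrow> real ^ 'n \<Rightarrow> real ^ 'n ^ 'm"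
  where "Jac F x \<equiv> jacobian F (at x)"

definition continuously_differentiable :: "(real ^ 'n \<Rightarrow> real ^ 'm) \<Rightarrow> bool"
  where "continuously_differentiable F \<longleftrightarrow>
    (\<forall>x. F differentiable (at x)) \<and> continuous_on UNIV (Jac F)"

definition critical_pareto :: "(real ^ 'n \<Rightarrow> real ^ 'm) \<Rightarrow> real ^ 'n \<Rightarrow> bool"
  where "critical_pareto F x \<longleftrightarrow> \<not> (\<exists>v. Jac F x *v v \<prec> 0)"

definition weak_pareto :: "(real ^ 'n \<Rightarrow> real ^ 'm) \<Rightarrow> real ^ 'n \<Rightarrow> bool"
  where "weak_pareto F x \<longleftrightarrow> \<not> (\<exists>y. F y \<prec> F x)"

definition pseudo_convex :: "(real ^ 'n \<Rightarrow> real ^ 'm) \<Rightarrow> bool"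
  where "pseudo_convex F \<longleftrightarrow>
    (\<forall>x. F differentiable (at x)) \<and>
    (\<forall>x y. \<not> Jac F x *v (y - x) \<prec> 0 \<longrightarrow> \<not> F y \<prec> F x)"

definition descent_model :: "(real ^ 'n \<Rightarrow> real ^ 'm) \<Rightarrow> real ^ 'n \<Rightarrow> real ^ 'n \<Rightarrow> real"
  where "descent_model F x v = (MAX i. (Jac F x *v v) $ i) + 1/2 * (norm v)\<^sup>2"

text \<open>The infimum is a minimum: \<open>descent_model F x\<close> is continuous and coercive.\<close>

definition descent_value :: "(real ^ 'n \<Rightarrow> real ^ 'm) \<Rightarrow> real ^ 'n \<Rightarrow> real"
  where "descent_value F x = (INF v. descent_model F x v)"

definition approx_steepest_descent ::
    "real \<Rightarrow> (real ^ 'n \<Rightarrow> real ^ 'm) \<Rightarrow> real ^ 'n \<Rightarrow> real ^ 'n \<Rightarrow> bool"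
  where "approx_steepest_descent \<sigma> F x v \<longleftrightarrow> descent_model F x v \<le> (1 - \<sigma>) * descent_value F x"

definition armijo_steps :: "real \<Rightarrow> (real ^ 'n \<Rightarrow> real ^ 'm) \<Rightarrow> real ^ 'n \<Rightarrow> real ^ 'n \<Rightarrow> real set"
  where "armijo_steps \<beta> F x v =
    {(1/2) ^ j | j::nat.
       F (x + (1/2) ^ j *\<^sub>R v) \<le> F x + (\<beta> * (1/2) ^ j) *\<^sub>R (Jac F x *v v)}"

text \<open>\<open>armijo_steps\<close> may be infinite, where \<^const>\<open>Max\<close> is unspecified; hence the maximum is
  spelled out.\<close>

definition armijo_step ::
    "real \<Rightarrow> (real ^ 'n \<Rightarrow> real ^ 'm) \<Rightarrow> real ^ 'n \<Rightarrow> real ^ 'n \<Rightarrow> real \<Rightarrow> bool"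
  where "armijo_step \<beta> F x v t \<longleftrightarrow>
    t \<in> armijo_steps \<beta> F x v \<and> (\<forall>s\<in>armijo_steps \<beta> F x v. s \<le> t)"

text \<open>An infinite run of the method, i.e. one whose stopping test never succeeds.\<close>

definition inexact_steepest_descent ::
    "real \<Rightarrow> real \<Rightarrow> (real ^ 'n \<Rightarrow> real ^ 'm) \<Rightarrow> real ^ 'n \<Rightarrow>
     (nat \<Rightarrow> real ^ 'n) \<Rightarrow> (nat \<Rightarrow> real ^ 'n) \<Rightarrow> (nat \<Rightarrow> real) \<Rightarrow> bool"
  where "inexact_steepest_descent \<sigma> \<beta> F x0 x v t \<longleftrightarrow>
    x 0 = x0 \<and>
    (\<forall>k. \<not> critical_pareto F (x k) \<and>
         approx_steepest_descent \<sigma> F (x k) (v k) \<and>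
         armijo_step \<beta> F (x k) (v k) (t k) \<and>
         x (Suc k) = x k + t k *\<^sub>R v k)"

text \<open>\<^term>\<open>Basis :: (real ^ 'm) set\<close> is the canonical basis of \<open>\<real>\<^sup>m\<close>.\<close>

definition scalarization_compatible ::
    "(real ^ 'n \<Rightarrow> real ^ 'm) \<Rightarrow> (nat \<Rightarrow> real ^ 'n) \<Rightarrow> (nat \<Rightarrow> real ^ 'n) \<Rightarrow> bool"
  where "scalarization_compatible F x v \<longleftrightarrow>
    (\<exists>w :: nat \<Rightarrow> real ^ 'm. \<forall>k.
       w k \<in> convex hull Basis \<and> v k = - (transpose (Jac F (x k)) *v w k))"

end

theory Submission
  imports Defs
begin

text \<open>Every iterate strictly decreases \<open>F\<close>, so a point \<open>y\<close> of \<open>U\<close> satisfies \<open>F y \<prec> F (x k)\<close> for all \<open>k\<close>,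
  and pseudo-convexity gives \<open>JF (x k) (y - x k) \<prec> 0\<close>.  Since \<open>v k\<close> is minus a convex combination of
  the gradients, \<open>v k\<close> makes an acute angle with \<open>y - x k\<close>, whence
  \<open>\<parallel>x (k + 1) - y\<parallel>\<^sup>2 \<le> \<parallel>x k - y\<parallel>\<^sup>2 + t k \<parallel>v k\<parallel>\<^sup>2\<close>.  The Armijo rule makes the error terms summable, so
  \<open>x\<close> is quasi-Fejer monotone with respect to \<open>U\<close>; its cluster points lie in \<open>U\<close> because \<open>F \<circ> x\<close>
  decreases, hence \<open>x\<close> converges.  If the limit were not critical, then \<open>JF (x k) (v k)\<close> would stay away
  from \<open>0\<close>, forcing \<open>t k \<longlonglongrightarrow> 0\<close>, and the rejected steps \<open>2 t k\<close> would contradict the mean value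
  theorem.  Critical points of pseudo-convex maps are weakly optimal.\<close>

section \<open>Quasi-Fejer convergence\<close>

text \<open>Summable errors still let the distance to each point of \<open>U\<close> converge, so
  \<open>x\<close> is bounded and has a cluster point. By \<open>cluster\<close> that point lies in
  \<open>U\<close> itself, which upgrades subsequential to full convergence.\<close>

lemma quasi_fejer_convergent:
  fixes x :: "nat \<Rightarrow> 'a :: heine_borel"
  assumes "U \<noteq> {}"
    and step: "\<And>k z. z \<in> U \<Longrightarrow> (dist (x (Suc k)) z)\<^sup>2 \<le> (dist (x k) z)\<^sup>2 + e k"
    and nonneg: "\<And>k. 0 \<le> e k" and "summable e"
    and cluster: "\<And>r l. strict_mono r \<Longrightarrow> (x \<circ> r) \<longlonglongrightarrow> l \<Longrightarrow> l \<in> U"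
  obtains l where "l \<in> U" and "x \<longlonglongrightarrow> l"
proof -
  have conv: "convergent (\<lambda>k. (dist (x k) z)\<^sup>2)" if "z \<in> U" for z
  proof -
    \<comment> \<open>Subtracting the errors accumulated so far restores monotonicity; summability
      bounds \<open>d\<close> from below.\<close>
    define d where "d k = (dist (x k) z)\<^sup>2 - (\<Sum>i<k. e i)" for k
    have "decseq d"
      using step[OF that] by (intro decseq_SucI) (simp add: d_def algebra_simps)
    moreover have "- suminf e \<le> d k" for k
    proof -
      have "(\<Sum>i<k. e i) \<le> suminf e"
        using \<open>summable e\<close> nonneg by (intro sum_le_suminf) auto
      then show ?thesis
        unfolding d_def using zero_le_power2[of "dist (x k) z"] by linarith
    qed
    ultimately obtain L where "d \<longlonglongrightarrow> L"
      using decseq_convergent[of d "- suminf e"] by blast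
    then have "(\<lambda>k. d k + (\<Sum>i<k. e i)) \<longlonglongrightarrow> L + suminf e"
      using \<open>summable e\<close> by (intro tendsto_add summable_LIMSEQ)
    then show ?thesis
      by (auto simp: d_def convergent_def)
  qed
  obtain z where z: "z \<in> U"
    using \<open>U \<noteq> {}\<close> by blast
  have "Bseq (\<lambda>k. (dist (x k) z)\<^sup>2)"
    using conv[OF z] by (rule convergent_imp_Bseq)
  then obtain B where "0 < B" and B: "\<And>k. (dist (x k) z)\<^sup>2 \<le> B"
    unfolding Bseq_def by auto
  have "dist z (x k) \<le> sqrt B" for k
    using B[of k] by (metis dist_commute real_le_rsqrt)
  then have "bounded (range x)"
    unfolding bounded_def by blast
  then obtain l r where r: "strict_mono (r :: nat \<Rightarrow> nat)" and lim: "(x \<circ> r) \<longlonglongrightarrow> l"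
    using bounded_imp_convergent_subsequence by blast
  have "l \<in> U"
    using cluster r lim .
  \<comment> \<open>The distances to \<open>l\<close> converge along the whole sequence; the
    subsequence identifies their limit as 0.\<close>
  obtain L where L: "(\<lambda>k. (dist (x k) l)\<^sup>2) \<longlonglongrightarrow> L"
    using conv[OF \<open>l \<in> U\<close>] by (auto simp: convergent_def)
  have "(\<lambda>k. (dist ((x \<circ> r) k) l)\<^sup>2) \<longlonglongrightarrow> (dist l l)\<^sup>2"
    by (intro tendsto_intros lim)
  moreover have "(\<lambda>k. (dist ((x \<circ> r) k) l)\<^sup>2) \<longlonglongrightarrow> L"
    using LIMSEQ_subseq_LIMSEQ[OF L r] by (simp add: o_def)
  ultimately have "L = (dist l l)\<^sup>2"
    by (rule LIMSEQ_unique[rotated])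
  then have "(\<lambda>k. sqrt ((dist (x k) l)\<^sup>2)) \<longlonglongrightarrow> sqrt 0"
    using tendsto_real_sqrt[OF L] by simp
  then have "x \<longlonglongrightarrow> l"
    by (simp add: tendsto_dist_iff[of x])
  with \<open>l \<in> U\<close> show thesis
    by (rule that)
qed

section \<open>Estimates for Jacobians and convex weights\<close>

lemma abs_matrix_vector_mult_nth_le:
  fixes A :: "real ^ 'n ^ 'm"
  shows "\<bar>(A *v u) $ i\<bar> \<le> norm A * norm u"
proof -
  have "\<bar>(A *v u) $ i\<bar> \<le> norm (A $ i) * norm u"
    unfolding matrix_vector_mul_component by (rule Cauchy_Schwarz_ineq2)
  also have "\<dots> \<le> norm A * norm u"
    by (intro mult_right_mono Finite_Cartesian_Product.norm_nth_le) auto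
  finally show ?thesis .
qed

text \<open>A closed half-space is convex, so it contains the hull once it contains the basis
  vectors.\<close>

lemma inner_convex_hull_Basis_nonpos:
  fixes w y :: "real ^ 'm"
  assumes "w \<in> convex hull Basis" and "\<And>i. y $ i \<le> 0"
  shows "w \<bullet> y \<le> 0"
proof -
  have "convex {w. y \<bullet> w \<le> 0}"
    by (rule convex_halfspace_le)
  moreover have "Basis \<subseteq> {w. y \<bullet> w \<le> 0}"
    using assms(2) by (auto simp: Basis_vec_def inner_axis)
  ultimately show ?thesis
    using assms(1) hull_minimal[of Basis "{w. y \<bullet> w \<le> 0}" convex] by (auto simp: inner_commute)
qed

text \<open>This is the one-variable mean value theorem for a single component along a segment. The
  point \<open>s\<close> may vary with \<open>i\<close>, which is harmless because only one rejected
  component is considered at a time.\<close>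

lemma jacobian_mean_value:
  fixes F :: "real ^ 'n \<Rightarrow> real ^ 'm"
  assumes "\<And>z. F differentiable (at z)" and "0 < \<tau>"
  obtains s where "0 < s" and "s < \<tau>"
    and "F (p + \<tau> *\<^sub>R u) $ i - F p $ i = \<tau> * (Jac F (p + s *\<^sub>R u) *v u) $ i"
proof -
  have D: "DERIV (\<lambda>s. F (p + s *\<^sub>R u) $ i) s :> (Jac F (p + s *\<^sub>R u) *v u) $ i" for s
  proof -
    have F: "(F has_derivative (*v) (Jac F (p + s *\<^sub>R u))) (at (p + s *\<^sub>R u))"
      using assms(1) jacobian_works by blast
    have "((\<lambda>s. p + s *\<^sub>R u) has_derivative (\<lambda>h. h *\<^sub>R u)) (at s)"
      by (auto intro!: derivative_eq_intros)
    from has_derivative_compose[OF this F]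
    have "((\<lambda>s. F (p + s *\<^sub>R u) $ i) has_derivative (\<lambda>h. (Jac F (p + s *\<^sub>R u) *v (h *\<^sub>R u)) $ i)) (at s)"
      by (rule bounded_linear.has_derivative[OF bounded_linear_vec_nth])
    then show ?thesis
      by (rule has_derivative_imp_has_field_derivative) (simp add: matrix_vector_mult_scaleR)
  qed
  obtain s where "0 < s" "s < \<tau>"
    "F (p + \<tau> *\<^sub>R u) $ i - F (p + 0 *\<^sub>R u) $ i = (\<tau> - 0) * (Jac F (p + s *\<^sub>R u) *v u) $ i"
    using MVT2[OF \<open>0 < \<tau>\<close> D] by blast
  then show thesis
    using that by simp
qed

section \<open>The descent model and its infimum\<close>

lemma descent_model_ge: "(Jac F p *v u) $ i + 1/2 * (norm u)\<^sup>2 \<le> descent_model F p u"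
  unfolding descent_model_def by simp

lemma descent_model_le:
  assumes "\<And>i. (Jac F p *v u) $ i \<le> c"
  shows "descent_model F p u \<le> c + 1/2 * (norm u)\<^sup>2"
  unfolding descent_model_def using assms by (auto simp: Max_le_iff)

text \<open>Completing the square: each slope is at least \<open>- (?N * norm u)\<close>, and the
  quadratic term compensates. Only with this bound is the infimum in \<open>descent_value\<close> a
  genuine lower bound of the model.\<close>

lemma bdd_below_descent_model: "bdd_below (range (descent_model F p))"
proof (rule bdd_belowI2)
  fix u
  let ?N = "norm (Jac F p)"
  have "- (?N * norm u) + 1/2 * (norm u)\<^sup>2 \<le> descent_model F p u"
    using descent_model_ge[of F p u] abs_matrix_vector_mult_nth_le[of "Jac F p" u] by smt
  moreover have "- (?N\<^sup>2) / 2 \<le> - (?N * norm u) + 1/2 * (norm u)\<^sup>2"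
    using zero_le_power2[of "?N - norm u"] by (simp add: power2_diff)
  ultimately show "- (?N\<^sup>2) / 2 \<le> descent_model F p u"
    by linarith
qed

lemma descent_value_le: "descent_value F p \<le> descent_model F p u"
  unfolding descent_value_def by (rule cINF_lower[OF bdd_below_descent_model UNIV_I])

lemma descent_value_nonpos: "descent_value F p \<le> 0"
  using order_trans[OF descent_value_le descent_model_le[of F p 0 0]] by simp

text \<open>The model is tested along the ray through one descent direction. The bound depends only
  on \<open>c\<close> and \<open>norm u\<close>, so it can hold uniformly for many points
  \<open>p\<close>.\<close>

lemma descent_value_quadratic_bound:
  assumes "\<And>i. (Jac F p *v u) $ i \<le> - c" and "0 < c"
  shows "u \<noteq> 0" and "descent_value F p \<le> - (c\<^sup>2 / (2 * (norm u)\<^sup>2))"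
proof -
  show "u \<noteq> 0"
    using assms by (metis matrix_vector_mult_0_right neg_0_le_iff_le not_le zero_index)
  \<comment> \<open>This \<open>s\<close> minimizes
    \<open>- (s * c) + 1/2 * s\<^sup>2 * (norm u)\<^sup>2\<close>.\<close>
  define s where "s = c / (norm u)\<^sup>2"
  have "0 < s"
    using \<open>u \<noteq> 0\<close> \<open>0 < c\<close> by (simp add: s_def)
  have "(Jac F p *v (s *\<^sub>R u)) $ i \<le> - (s * c)" for i
    using assms(1)[of i] \<open>0 < s\<close> mult_left_mono[of "(Jac F p *v u) $ i" "- c" s]
    by (simp add: matrix_vector_mult_scaleR)
  then have "descent_value F p \<le> - (s * c) + 1/2 * (norm (s *\<^sub>R u))\<^sup>2"
    using descent_value_le descent_model_le order_trans by meson
  also have "\<dots> = - (c\<^sup>2 / (2 * (norm u)\<^sup>2))"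
    using \<open>u \<noteq> 0\<close> by (simp add: s_def power_mult_distrib field_simps power2_eq_square)
  finally show "descent_value F p \<le> - (c\<^sup>2 / (2 * (norm u)\<^sup>2))" .
qed

lemma strictly_below_0_bound:
  fixes y :: "real ^ 'm"
  assumes "y \<prec> 0"
  shows "\<exists>c>0. \<forall>i. y $ i \<le> - c"
proof (intro exI conjI allI)
  show "0 < - Max (range (($) y))"
    using assms by (simp add: strictly_below_def)
  show "y $ i \<le> - (- Max (range (($) y)))" for i
    unfolding minus_minus by (rule Max_ge) auto
qed

lemma descent_value_neg:
  assumes "\<not> critical_pareto F p"
  shows "descent_value F p < 0"
proof -
  obtain u where "Jac F p *v u \<prec> 0"
    using assms by (auto simp: critical_pareto_def)
  then obtain c where "0 < c" "\<And>i. (Jac F p *v u) $ i \<le> - c"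
    using strictly_below_0_bound by blast
  then have "u \<noteq> 0" "descent_value F p \<le> - (c\<^sup>2 / (2 * (norm u)\<^sup>2))"
    using descent_value_quadratic_bound by blast+
  moreover from this have "0 < c\<^sup>2 / (2 * (norm u)\<^sup>2)"
    using \<open>0 < c\<close> by simp
  ultimately show ?thesis
    by linarith
qed

lemma pseudo_convex_critical_imp_weak_pareto:
  "pseudo_convex F \<Longrightarrow> critical_pareto F p \<Longrightarrow> weak_pareto F p"
  unfolding pseudo_convex_def critical_pareto_def weak_pareto_def by blast

section \<open>Accepted and rejected Armijo steps\<close>

lemma armijo_stepD:
  assumes "armijo_step \<beta> F p u t"
  shows "0 < t" and "t \<le> 1"
    and "F (p + t *\<^sub>R u) $ i \<le> F p $ i + \<beta> * t * (Jac F p *v u) $ i"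
proof -
  obtain j where j: "t = (1/2) ^ j"
    and "F (p + t *\<^sub>R u) \<le> F p + (\<beta> * t) *\<^sub>R (Jac F p *v u)"
    using assms by (auto simp: armijo_step_def armijo_steps_def)
  then show "F (p + t *\<^sub>R u) $ i \<le> F p $ i + \<beta> * t * (Jac F p *v u) $ i"
    by (simp add: less_eq_vec_def)
  show "0 < t" "t \<le> 1"
    by (simp_all add: j power_le_one)
qed

text \<open>As \<open>t < 1\<close> excludes exponent 0, \<open>2 * t\<close> is again a trial step;
  maximality of \<open>t\<close> rejects it, and rejection in the componentwise order means failure
  in some component.\<close>

lemma armijo_step_double_rejected:
  assumes "armijo_step \<beta> F p u t" and "t < 1"
  obtains i where "F p $ i + \<beta> * (2 * t) * (Jac F p *v u) $ i < F (p + (2 * t) *\<^sub>R u) $ i"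
proof -
  obtain j where j: "t = (1/2) ^ j"
    using assms by (auto simp: armijo_step_def armijo_steps_def)
  with \<open>t < 1\<close> obtain j' where "j = Suc j'"
    by (cases j) auto
  with j have j': "2 * t = (1/2) ^ j'"
    by simp
  have "2 * t \<notin> armijo_steps \<beta> F p u"
    using assms(1) armijo_stepD(1)[OF assms(1)] by (force simp: armijo_step_def)
  then have "\<not> F (p + (2 * t) *\<^sub>R u) \<le> F p + (\<beta> * (2 * t)) *\<^sub>R (Jac F p *v u)"
    unfolding armijo_steps_def j' by blast
  then show thesis
    using that by (auto simp: less_eq_vec_def not_le)
qed

section \<open>Criticality of the limit\<close>

lemma armijo_limit_critical:
  fixes F :: "real ^ 'n \<Rightarrow> real ^ 'm"
  assumes "continuously_differentiable F"
    and "\<sigma> < 1" and "\<beta> < 1"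
    and dir: "\<And>k. approx_steepest_descent \<sigma> F (x k) (v k)"
    and armijo: "\<And>k. armijo_step \<beta> F (x k) (v k) (t k)"
    and lim: "x \<longlonglongrightarrow> l"
    and small: "\<And>i. (\<lambda>k. t k * (Jac F (x k) *v v k) $ i) \<longlonglongrightarrow> 0"
  shows "critical_pareto F l"
proof (rule ccontr)
  assume "\<not> critical_pareto F l"
  then obtain u where "Jac F l *v u \<prec> 0"
    by (auto simp: critical_pareto_def)
  then obtain c where "0 < c" and c: "\<And>i. (Jac F l *v u) $ i \<le> - c"
    using strictly_below_0_bound by blast
  have diff: "\<And>z. F differentiable (at z)" and cont: "isCont (Jac F) l"
    using assms(1) by (auto simp: continuously_differentiable_def continuous_on_eq_continuous_at)
  have J: "(\<lambda>k. Jac F (x k)) \<longlonglongrightarrow> Jac F l"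
    using isCont_tendsto_compose[OF cont lim] .
  have dir': "(Jac F (x k) *v v k) $ i + 1/2 * (norm (v k))\<^sup>2 \<le> (1 - \<sigma>) * descent_value F (x k)" for i k
    using dir[of k] descent_model_ge[of F "x k" "v k" i] by (simp add: approx_steepest_descent_def)

  \<comment> \<open>Near \<open>l\<close> the direction \<open>u\<close> keeps slopes at most
    \<open>- (c/2)\<close>; \<open>\<delta>\<close> is the resulting uniform bound on the slopes of
    \<open>v k\<close>.\<close>
  define \<delta> where "\<delta> = (1 - \<sigma>) * ((c/2)\<^sup>2 / (2 * (norm u)\<^sup>2))"
  have "u \<noteq> 0"
    using descent_value_quadratic_bound(1)[OF c \<open>0 < c\<close>] .
  then have "0 < \<delta>"
    using \<open>0 < c\<close> \<open>\<sigma> < 1\<close> by (simp add: \<delta>_def)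
  have "\<forall>\<^sub>F k in sequentially. (Jac F (x k) *v u) $ i \<le> - (c/2)" for i
  proof -
    have "(\<lambda>k. (Jac F (x k) $ i) \<bullet> u) \<longlonglongrightarrow> (Jac F l $ i) \<bullet> u"
      by (intro tendsto_intros J)
    moreover have "(Jac F l $ i) \<bullet> u < - (c/2)"
      using c[of i] \<open>0 < c\<close> by (simp add: matrix_vector_mul_component)
    ultimately have "\<forall>\<^sub>F k in sequentially. (Jac F (x k) $ i) \<bullet> u < - (c/2)"
      by (rule order_tendstoD)
    then show ?thesis
      by eventually_elim (simp add: matrix_vector_mul_component)
  qed
  then have "\<forall>\<^sub>F k in sequentially. \<forall>i. (Jac F (x k) *v u) $ i \<le> - (c/2)"
    by (rule eventually_all_finite)
  then have steep: "\<forall>\<^sub>F k in sequentially. \<forall>i. (Jac F (x k) *v v k) $ i \<le> - \<delta>"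
  proof eventually_elim
    case (elim k)
    then have "descent_value F (x k) \<le> - ((c/2)\<^sup>2 / (2 * (norm u)\<^sup>2))"
      using \<open>0 < c\<close> by (intro descent_value_quadratic_bound(2)) auto
    then have "(1 - \<sigma>) * descent_value F (x k) \<le> - \<delta>"
      using mult_left_mono[of "descent_value F (x k)" _ "1 - \<sigma>"] \<open>\<sigma> < 1\<close> by (fastforce simp: \<delta>_def)
    moreover have "(Jac F (x k) *v v k) $ i \<le> (1 - \<sigma>) * descent_value F (x k)" for i
      using dir'[of k i] zero_le_power2[of "norm (v k)"] by linarith
    ultimately show ?case
      using order_trans by blast
  qed

  \<comment> \<open>Here \<open>undefined\<close> is just some index; any component would
    do.\<close>
  have "t \<longlonglongrightarrow> 0"
  proof (rule Lim_null_comparison)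
    show "\<forall>\<^sub>F k in sequentially. norm (t k) \<le> - (t k * (Jac F (x k) *v v k) $ undefined) / \<delta>"
      using steep
    proof eventually_elim
      case (elim k)
      then have "t k * (Jac F (x k) *v v k) $ undefined \<le> t k * - \<delta>"
        using armijo_stepD(1)[OF armijo, of k] by (intro mult_left_mono) auto
      then show ?case
        using armijo_stepD(1)[OF armijo, of k] \<open>0 < \<delta>\<close> by (simp add: field_simps)
    qed
    show "(\<lambda>k. - (t k * (Jac F (x k) *v v k) $ undefined) / \<delta>) \<longlonglongrightarrow> 0"
      using tendsto_divide[OF tendsto_minus[OF small[of undefined]] tendsto_const[of \<delta>]] \<open>0 < \<delta>\<close> by simp
  qed

  obtain K where "0 < K" and K: "\<And>k. norm (Jac F (x k)) \<le> K"
    using convergent_imp_Bseq[OF convergentI[OF J]] by (auto simp: Bseq_def)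
  \<comment> \<open>The model value at \<open>v k\<close> is nonpositive, so half the squared norm
    is at most \<open>K * norm (v k)\<close>.\<close>
  have v: "norm (v k) \<le> 2 * K" for k
  proof -
    have "(Jac F (x k) *v v k) $ undefined + 1/2 * (norm (v k))\<^sup>2 \<le> 0"
      using dir'[of k undefined] mult_nonneg_nonpos[OF _ descent_value_nonpos[of F "x k"], of "1 - \<sigma>"] \<open>\<sigma> < 1\<close>
      by linarith
    moreover have "\<bar>(Jac F (x k) *v v k) $ undefined\<bar> \<le> K * norm (v k)"
      using abs_matrix_vector_mult_nth_le mult_right_mono[OF K norm_ge_zero] order_trans by blast
    ultimately have "norm (v k) * norm (v k) \<le> (2 * K) * norm (v k)"
      by (simp add: power2_eq_square)
    then show ?thesis
      using \<open>0 < K\<close> by (cases "v k = 0") auto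
  qed

  \<comment> \<open>Going from \<open>z\<close> to \<open>x k\<close> via \<open>l\<close> costs
    \<open>2 * \<eta>\<close> in the Jacobian; times \<open>norm (v k) \<le> 2 * K\<close> this is
    \<open>(1 - \<beta>) * \<delta>\<close>.\<close>
  define \<eta> where "\<eta> = (1 - \<beta>) * \<delta> / (4 * K)"
  have "0 < \<eta>"
    using \<open>\<beta> < 1\<close> \<open>0 < \<delta>\<close> \<open>0 < K\<close> by (simp add: \<eta>_def)
  then obtain r where "0 < r" and r: "\<And>z. dist z l < r \<Longrightarrow> dist (Jac F z) (Jac F l) < \<eta>"
    using cont unfolding continuous_at_eps_delta by blast
  have "\<forall>\<^sub>F k in sequentially. dist (x k) l < r / 2"
    using lim \<open>0 < r\<close> by (intro tendstoD) auto
  \<comment> \<open>The bound 1 makes the doubled step a rejected trial; \<open>r / (8 * K)\<close>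
    keeps that step, of length at most \<open>2 * t k * (2 * K)\<close>, below
    \<open>r / 2\<close>.\<close>
  moreover have "\<forall>\<^sub>F k in sequentially. t k < min 1 (r / (8 * K))"
    using \<open>t \<longlonglongrightarrow> 0\<close> by (rule order_tendstoD) (use \<open>0 < r\<close> \<open>0 < K\<close> in auto)
  ultimately have "\<forall>\<^sub>F k in sequentially. False"
    using steep
  proof eventually_elim
    case (elim k)
    define a where "a i = (Jac F (x k) *v v k) $ i" for i
    have "0 < t k"
      using armijo_stepD(1)[OF armijo] .
    obtain i where i: "F (x k) $ i + \<beta> * (2 * t k) * a i < F (x k + (2 * t k) *\<^sub>R v k) $ i"
      using armijo_step_double_rejected[OF armijo, of k] elim(2) unfolding a_def by auto
    obtain s where s: "0 < s" "s < 2 * t k"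
      and mv: "F (x k + (2 * t k) *\<^sub>R v k) $ i - F (x k) $ i
        = 2 * t k * (Jac F (x k + s *\<^sub>R v k) *v v k) $ i"
      using jacobian_mean_value[OF diff, of "2 * t k" "x k" "v k" i] \<open>0 < t k\<close> by auto
    define z where "z = x k + s *\<^sub>R v k"
    have "2 * t k * (\<beta> * a i) < 2 * t k * (Jac F z *v v k) $ i"
      using i mv by (simp add: z_def algebra_simps)
    then have "\<beta> * a i < (Jac F z *v v k) $ i"
      using \<open>0 < t k\<close> by simp
    moreover have "(Jac F z *v v k) $ i - a i \<le> (1 - \<beta>) * \<delta>"
    proof -
      have "dist z (x k) = s * norm (v k)"
        using s by (simp add: z_def dist_norm)
      also have "\<dots> \<le> (2 * t k) * (2 * K)"
        using s v[of k] by (intro mult_mono) auto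
      also have "\<dots> < r / 2"
        using elim(2) \<open>0 < K\<close> by (simp add: field_simps)
      finally have "dist z l < r"
        using elim(1) dist_triangle[of z l "x k"] by linarith
      then have "dist (Jac F z) (Jac F (x k)) \<le> 2 * \<eta>"
        using r[of z] r[of "x k"] elim(1) \<open>0 < r\<close> dist_triangle2[of "Jac F z" "Jac F (x k)" "Jac F l"]
        by linarith
      then have "norm (Jac F z - Jac F (x k)) * norm (v k) \<le> (2 * \<eta>) * (2 * K)"
        using v[of k] \<open>0 < \<eta>\<close> by (intro mult_mono) (auto simp: dist_norm)
      also have "\<dots> = (1 - \<beta>) * \<delta>"
        using \<open>0 < K\<close> by (simp add: \<eta>_def)
      finally show ?thesis
        using abs_matrix_vector_mult_nth_le[of "Jac F z - Jac F (x k)" "v k" i]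
        by (simp add: matrix_vector_mult_diff_rdistrib a_def)
    qed
    \<comment> \<open>The two preceding facts give
      \<open>(1 - \<beta>) * a i > - ((1 - \<beta>) * \<delta>)\<close>, against
      \<open>a i \<le> - \<delta>\<close>.\<close>
    moreover have "(1 - \<beta>) * a i \<le> (1 - \<beta>) * - \<delta>"
      using elim(3) \<open>\<beta> < 1\<close> by (intro mult_left_mono) (auto simp: a_def)
    ultimately show False
      by (simp add: algebra_simps)
  qed
  then show False
    by simp
qed

section \<open>Convergence of the iterates\<close>

theorem corollary5p1:
  fixes F :: "real ^ 'n \<Rightarrow> real ^ 'm"
    and \<sigma> \<beta> :: real
    and x0 :: "real ^ 'n"
    and x v :: "nat \<Rightarrow> real ^ 'n"
    and t :: "nat \<Rightarrow> real"
  assumes "continuously_differentiable F"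
    and "0 \<le> \<sigma>" and "\<sigma> < 1"
    and "0 < \<beta>" and "\<beta> < 1"
    and "inexact_steepest_descent \<sigma> \<beta> F x0 x v t"
    and "scalarization_compatible F x v"
    and "pseudo_convex F"
    and "{y. \<forall>k. F y \<le> F (x k)} \<noteq> {}"
  shows "\<exists>x'. x \<longlonglongrightarrow> x' \<and> weak_pareto F x'"
proof -
  define U where "U = {y. \<forall>k. F y \<le> F (x k)}"
  define a where "a k i = (Jac F (x k) *v v k) $ i" for k i
  have noncrit: "\<not> critical_pareto F (x k)"
    and dir: "approx_steepest_descent \<sigma> F (x k) (v k)"
    and armijo: "armijo_step \<beta> F (x k) (v k) (t k)"
    and next_x: "x (Suc k) = x k + t k *\<^sub>R v k" for k
    using assms(6) by (auto simp: inexact_steepest_descent_def)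
  have t: "0 < t k" "t k \<le> 1" for k
    using armijo_stepD[OF armijo] by blast+
  have a: "a k i + 1/2 * (norm (v k))\<^sup>2 < 0" for k i
  proof -
    have "(1 - \<sigma>) * descent_value F (x k) < 0"
      using descent_value_neg[OF noncrit[of k]] \<open>\<sigma> < 1\<close> by (simp add: mult_pos_neg)
    then show ?thesis
      using dir[of k] descent_model_ge[of F "x k" "v k" i]
      by (simp add: approx_steepest_descent_def a_def)
  qed
  have a_neg: "a k i < 0" for k i
    using a[of k i] zero_le_power2[of "norm (v k)"] by linarith
  have decr: "F (x (Suc k)) $ i \<le> F (x k) $ i + \<beta> * (t k * a k i)" for k i
    using armijo_stepD(3)[OF armijo[of k], of i] by (simp add: next_x a_def mult.assoc)
  have "F (x (Suc k)) \<prec> F (x k)" for k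
    unfolding strictly_below_def
    using decr[of k] mult_pos_neg[OF \<open>0 < \<beta>\<close> mult_pos_neg[OF t(1) a_neg]] by (smt (verit))
  \<comment> \<open>Membership in \<open>U\<close> gives only the weak order; strictness comes from
    comparing with iterate \<open>Suc k\<close> first.\<close>
  then have strict: "F y \<prec> F (x k)" if "y \<in> U" for y k
    using that by (fastforce simp: U_def strictly_below_def less_eq_vec_def intro: le_less_trans)

  obtain y where y: "y \<in> U"
    using assms(9) by (auto simp: U_def)
  \<comment> \<open>The Armijo decreases telescope, and \<open>F y\<close> bounds the total
    decrease.\<close>
  have summ: "summable (\<lambda>k. - (t k * a k i))" for i
  proof (rule summableI_nonneg_bounded)
    show "0 \<le> - (t k * a k i)" for k
      using mult_pos_neg[OF t(1) a_neg, of k k i] by linarith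
    show "(\<Sum>k<n. - (t k * a k i)) \<le> (F (x 0) $ i - F y $ i) / \<beta>" for n
    proof -
      have "\<beta> * (\<Sum>k<n. - (t k * a k i)) \<le> F (x 0) $ i - F (x n) $ i"
      proof (induction n)
        case (Suc n)
        then show ?case
          using decr[of n i] by (simp add: algebra_simps)
      qed simp
      also have "\<dots> \<le> F (x 0) $ i - F y $ i"
        using y by (simp add: U_def less_eq_vec_def)
      finally show ?thesis
        using \<open>0 < \<beta>\<close> by (simp add: field_simps)
    qed
  qed
  have small: "(\<lambda>k. t k * (Jac F (x k) *v v k) $ i) \<longlonglongrightarrow> 0" for i
    using tendsto_minus[OF summable_LIMSEQ_zero[OF summ[of i]]] by (simp add: a_def)

  \<comment> \<open>The second-order term of the squared distance. Since \<open>t k \<le> 1\<close>,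
    it is at most \<open>t k * (norm (v k))\<^sup>2\<close>, which \<open>a\<close> bounds by the
    summable \<open>2 * - (t k * a k i)\<close>.\<close>
  define e where "e k = (t k)\<^sup>2 * (norm (v k))\<^sup>2" for k
  have "summable e"
  proof (rule summable_comparison_test')
    show "summable (\<lambda>k. 2 * - (t k * a k undefined))"
      by (intro summable_mult summ)
    show "norm (e k) \<le> 2 * - (t k * a k undefined)" for k
    proof -
      have "e k \<le> t k * (norm (v k))\<^sup>2"
        unfolding e_def power2_eq_square[of "t k"]
        using t[of k] by (intro mult_right_mono) (auto simp: mult_left_le)
      also have "\<dots> \<le> t k * (2 * - a k undefined)"
        using a[of k undefined] t(1)[of k] by (intro mult_left_mono) auto
      finally show ?thesis
        by (simp add: e_def)
    qed
  qed

  have fejer: "(dist (x (Suc k)) y)\<^sup>2 \<le> (dist (x k) y)\<^sup>2 + e k" if "y \<in> U" for y k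
  proof -
    obtain w where w: "w \<in> convex hull Basis" "v k = - (transpose (Jac F (x k)) *v w)"
      using assms(7) by (auto simp: scalarization_compatible_def)
    have "Jac F (x k) *v (y - x k) \<prec> 0"
      using assms(8) strict[OF that] by (auto simp: pseudo_convex_def)
    then have "w \<bullet> (Jac F (x k) *v (y - x k)) \<le> 0"
      by (intro inner_convex_hull_Basis_nonpos[OF w(1)]) (simp add: strictly_below_def less_imp_le)
    \<comment> \<open>Moving the transpose across the inner product turns
      \<open>(x k - y) \<bullet> v k\<close> into
      \<open>w \<bullet> (Jac F (x k) *v (y - x k))\<close>.\<close>
    then have "(x k - y) \<bullet> v k \<le> 0"
      by (simp add: w(2) dot_lmul_matrix[symmetric] transpose_matrix_vector inner_diff_right
          inner_diff_left inner_commute)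
    then have "t k * ((x k - y) \<bullet> v k) \<le> 0"
      using t(1)[of k] by (simp add: mult_nonneg_nonpos)
    moreover have "(dist (x (Suc k)) y)\<^sup>2 = (norm ((x k - y) + t k *\<^sub>R v k))\<^sup>2"
      by (simp add: next_x dist_norm algebra_simps)
    moreover have "\<dots> = (dist (x k) y)\<^sup>2 + 2 * (t k * ((x k - y) \<bullet> v k)) + e k"
      unfolding e_def dist_norm power2_norm_eq_inner
      by (simp add: inner_add_left inner_add_right power2_eq_square inner_commute)
    ultimately show ?thesis
      by linarith
  qed

  have cont: "isCont F z" for z
    using assms(1) by (simp add: continuously_differentiable_def differentiable_imp_continuous_within)
  obtain l where l: "l \<in> U" "x \<longlonglongrightarrow> l"
  proof (rule quasi_fejer_convergent[of U x e])
    show "U \<noteq> {}"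
      using assms(9) by (simp add: U_def)
    show "0 \<le> e k" for k
      by (simp add: e_def)
    fix r l
    assume r: "strict_mono r" and "(x \<circ> r) \<longlonglongrightarrow> l"
    then have lim: "(\<lambda>k. F (x (r k)) $ i) \<longlonglongrightarrow> F l $ i" for i
      using isCont_tendsto_compose[OF cont, of "x \<circ> r"] by (intro tendsto_vec_nth) simp
    have dec: "decseq (\<lambda>k. F (x k) $ i)" for i
      using decr mult_pos_neg[OF \<open>0 < \<beta>\<close> mult_pos_neg[OF t(1) a_neg]]
      by (intro decseq_SucI) (smt (verit))
    \<comment> \<open>For \<open>n \<ge> k\<close> also \<open>r n \<ge> k\<close>, so monotonicity
      bounds the tail of the subsequence by \<open>F (x k) $ i\<close>.\<close>
    have "F l $ i \<le> F (x k) $ i" for k i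
    proof (rule LIMSEQ_le_const2[OF lim])
      show "\<exists>N. \<forall>n\<ge>N. F (x (r n)) $ i \<le> F (x k) $ i"
        using decseqD[OF dec[of i]] seq_suble[OF r] le_trans by blast
    qed
    then show "l \<in> U"
      by (simp add: U_def less_eq_vec_def)
  qed (use fejer \<open>summable e\<close> in auto)

  have "critical_pareto F l"
    using armijo_limit_critical[OF assms(1,3,5) dir armijo l(2) small] .
  then show ?thesis
    using l(2) pseudo_convex_critical_imp_weak_pareto[OF assms(8)] by blast
qed

end
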